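(* Let $n\ge 13$ be an integer. Then \[ ex(n)=\begin{cases}\dfrac{n^2+4n-1}{4}, & \text{if } n \text{ is odd};\\[2mm] \dfrac{n^2+4n}{4}, & \text{if } n/2 \text{ is even};\\[2mm] \dfrac{n^2+4n-4}{4}, & \text{if } n/2 \text{ is odd}.\end{cases} \]
   Context: All digraphs are strict: no loops and no parallel arcs (but two opposite arcs $u\to w$ and $w\to u$, a 2-cycle, are allowed). $P_{2,2}$ denotes the orientation of the 4-cycle consisting of four distinct vertices $a,b,c,d$ and the arcs $a\to b$, $b\to d$, $a\to c$, $c\to d$ (two directed paths of length 2 with the same initial vertex and the same terminal vertex). A digraph is $P_{2,2}$-free if it contains no (not necessarily induced) subdigraph isomorphic to $P_{2,2}$. $ex(n)$ denotes the maximum number of arcs of a $P_{2,2}$-free digraph on $n$ vertices. *)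

theory Defs
  imports Main
begin

(* A strict digraph on vertex set V: arc set A \<subseteq> V \<times> V without loops.
   Arcs are ordered pairs, so parallel arcs are impossible; opposite arcs allowed. *)
definition strict_digraph :: "'a set \<Rightarrow> ('a \<times> 'a) set \<Rightarrow> bool" where
  "strict_digraph V A \<longleftrightarrow> A \<subseteq> V \<times> V \<and> (\<forall>v. (v, v) \<notin> A)"

definition contains_P22 :: "('a \<times> 'a) set \<Rightarrow> bool" where
  "contains_P22 A \<longleftrightarrow> (\<exists>a b c d. distinct [a, b, c, d] \<and>
      (a, b) \<in> A \<and> (b, d) \<in> A \<and> (a, c) \<in> A \<and> (c, d) \<in> A)"

definition P22_free :: "('a \<times> 'a) set \<Rightarrow> bool" where
  "P22_free A \<longleftrightarrow> \<not> contains_P22 A"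

definition ex :: "nat \<Rightarrow> nat" where
  "ex n = Max {card A | A :: (nat \<times> nat) set. strict_digraph {..<n} A \<and> P22_free A}"

end

theory Submission
  imports Defs
begin

text \<open>
  For the upper bound, let a be a vertex of maximum out-degree D, let S be its set of out-neighbours
  and T the rest. In a P22-free digraph the out-neighbourhoods of the vertices in S are disjoint
  apart from a, so card A = n - 1 + card B + D (n - D) - \<open>\<Delta>\<close>, where B consists of the vertices of
  S with an arc back to a, and \<open>\<Delta>\<close> counts the missing out-degrees in T and the vertices R that S
  does not reach. Each vertex of T other than a sees at most one vertex of B, so a large B forces arcs
  inside T, and those are few because two such arcs from one vertex lead to vertices with disjoint
  out-neighbourhoods of size about n/2. Hence a digraph that is at least as large as claimed has
  card B at most 2, at most one arc inside T from each vertex, and \<open>\<Delta>\<close> at most 1. It is then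
  a complete bipartite digraph up to few arcs, and counting the arcs that return from its sink side,
  together with the parity of a fixed-point-free involution, excludes the remaining cases.

  For the lower bound, take all arcs from a set P to a set Q of about the same size, one arc
  from each i in P to f i in P, and a matching from Q into P that avoids every f (f i) different from i.
\<close>

section \<open>Preliminaries\<close>

lemma even_card_involution:
  assumes "finite X" and "\<And>x. x \<in> X \<Longrightarrow> g x \<in> X"
    and "\<And>x. x \<in> X \<Longrightarrow> g (g x) = x" and "\<And>x. x \<in> X \<Longrightarrow> g x \<noteq> x"
  shows "even (card X)"
  using assms
proof (induction "card X" arbitrary: X rule: less_induct)
  case less
  show ?case
  proof (cases "X = {}")
    case False
    then obtain x where x: "x \<in> X" by blast
    let ?Y = "X - {x, g x}"
    have two: "card {x, g x} = 2" using less.prems(4)[OF x] by simp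
    have sub: "{x, g x} \<subseteq> X" using x less.prems(2) by blast
    have card: "card X = card ?Y + 2"
      using card_Diff_subset[OF _ sub] card_mono[OF less.prems(1) sub] two by simp
    have "g y \<in> ?Y" if "y \<in> ?Y" for y
      using that less.prems(2,3) x by (metis Diff_iff empty_iff insert_iff)
    then have "even (card ?Y)"
      using less.prems card by (intro less.hyps) auto
    then show ?thesis using card by simp
  qed simp
qed

text \<open>In the application \<open>n\<close> is the number of vertices, \<open>D\<close> the
  maximum out-degree, \<open>c = card B\<close>, and \<open>M\<close> the largest number of arcs
  inside \<open>T\<close> from one vertex of \<open>T\<close>. \<open>square\<close> keeps
  \<open>D\<close> near \<open>n / 2\<close> and gives \<open>\<Delta> < c\<close>. Then
  \<open>out_all\<close> yields \<open>M \<le> 4\<close>, and \<open>miss\<close> with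
  \<open>out_S\<close> leaves only a few values of \<open>D\<close> and \<open>M\<close>, which
  \<open>n \<ge> 13\<close> excludes.\<close>

lemma degree_arithmetic:
  fixes n D c M \<Delta> :: int
  assumes n: "n \<ge> 13" and nonneg: "0 \<le> M" "0 \<le> \<Delta>" and c: "c \<le> D"
    and square: "4 * \<Delta> + (n - 2 * D)\<^sup>2 \<le> 4 * (c - 1)"
    and miss: "(n - D - 1) * (c - 1) \<le> (n - D - 1) * M + \<Delta>"
    and out_all: "M * D \<le> n - 1 + \<Delta> + M"
    and out_S: "M * D \<le> D + M * M + \<Delta>"
  shows "M \<le> 1 \<and> c \<le> 2 \<and> D + 4 \<le> n"
proof -
  define q where "q = (n - 2 * D)\<^sup>2"
  have q0: "0 \<le> q" by (simp add: q_def)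
  have square': "4 * \<Delta> + q + 4 \<le> 4 * c" using square by (simp add: q_def)
  have \<Delta>c: "\<Delta> \<le> c - 1" using square' q0 by presburger
  have qD: "q + 4 \<le> 4 * D" using square' c nonneg by presburger
  have nD: "D + 4 \<le> n"
  proof (rule ccontr)
    assume "\<not> D + 4 \<le> n"
    then have "D - 3 \<le> 2 * D - n" "D \<ge> 10" using n by auto
    then have "(D - 3)\<^sup>2 \<le> (2 * D - n)\<^sup>2" by (intro power_mono) auto
    moreover have "(2 * D - n)\<^sup>2 = q" by (simp add: q_def power2_commute)
    ultimately have "(D - 3)\<^sup>2 \<le> 4 * (D - 1)" using qD by simp
    then have "D * (D - 10) + 13 \<le> 0" by (simp add: power2_eq_square algebra_simps)
    moreover have "D * (D - 10) \<ge> 0" using \<open>D \<ge> 10\<close> by simp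
    ultimately show False by linarith
  qed
  have D5: "D \<ge> 5"
  proof (rule ccontr)
    assume "\<not> D \<ge> 5"
    then have "5 \<le> n - 2 * D" using n by linarith
    then have "5\<^sup>2 \<le> q" unfolding q_def by (intro power_mono) auto
    then show False using qD \<open>\<not> D \<ge> 5\<close> by simp
  qed
  have M4: "M \<le> 4"
  proof (rule ccontr)
    assume "\<not> M \<le> 4"
    then have "5 * (D - 1) \<le> M * (D - 1)" using D5 by (intro mult_right_mono) auto
    also have "\<dots> \<le> n - 1 + \<Delta>" using out_all by (simp add: algebra_simps)
    finally have "2 * D - 3 \<le> n - 2 * D" using \<Delta>c c by presburger
    then have "(2 * D - 3)\<^sup>2 \<le> q" using D5 unfolding q_def by (intro power_mono) auto
    then have "4 * (D * (D - 4)) + 13 \<le> 0"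
      using qD by (simp add: power2_eq_square algebra_simps)
    moreover have "D * (D - 4) \<ge> 0" using D5 by simp
    ultimately show False by linarith
  qed
  \<comment> \<open>\<open>\<Delta>\<close> is absorbed by \<open>\<Delta> \<le> c - 1\<close>,
    which turns the factor \<open>n - D - 1\<close> of \<open>c - 1\<close> into
    \<open>n - D - 2\<close>.\<close>
  have miss': "(n - D - 2) * (c - 1 - M) \<le> M"
    using miss \<Delta>c by (simp add: algebra_simps)
  have miss_le: "r * (c - 1 - M) \<le> M" if "r \<le> n - D - 2" "r \<ge> 0" for r
  proof (cases "c - 1 - M \<ge> 0")
    case True
    then have "r * (c - 1 - M) \<le> (n - D - 2) * (c - 1 - M)"
      using that by (intro mult_right_mono) auto
    then show ?thesis using miss' by linarith
  next
    case False
    then have "r * (c - 1 - M) \<le> 0" using that by (simp add: mult_nonneg_nonpos)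
    then show ?thesis using nonneg by linarith
  qed
  have two: "2 * (c - 1 - M) \<le> M" using miss_le[of 2] nD by simp
  have sq_ge: "j\<^sup>2 \<le> q" if "0 \<le> j" "j \<le> n - 2 * D" for j
    using that unfolding q_def by (intro power_mono) auto
  have M1: "M \<le> 1"
  proof (rule ccontr)
    assume "\<not> M \<le> 1"
    then have M: "M = 2 \<or> M = 3 \<or> M = 4" using M4 by linarith
    \<comment> \<open>By \<open>two\<close>, \<Delta> is at most c - 1 \<le> 3M/2, so
      \<open>out_S\<close> gives (M - 1) D \<le> M*M + 3M/2, and each of the three values of M
      forces D \<le> 7.\<close>
    then have D7: "D \<le> 7" using out_S two \<Delta>c by auto
    with n have four: "4 * (c - 1 - M) \<le> M" using miss_le[of 4] by simp
    \<comment> \<open>The square is replaced by linear lower bounds according to the size of the gap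
      \<open>n - 2 * D\<close>, so that linear reasoning can finish.\<close>
    have sq: "n \<le> 2 * D \<or> 1 \<le> q" "n \<le> 2 * D + 2 \<or> 9 \<le> q" "n \<le> 2 * D + 4 \<or> 25 \<le> q"
      using sq_ge[of 1] sq_ge[of 3] sq_ge[of 5] by fastforce+
    from D5 D7 consider "D = 5" | "D = 6" | "D = 7" by linarith
    then show False
      using M
      by cases (elim disjE; use n q0 square' \<Delta>c out_all out_S four sq in \<open>auto; presburger\<close>)+
  qed
  moreover have "c \<le> 2" using two M1 by presburger
  ultimately show ?thesis using nD by simp
qed

section \<open>Counting arcs around a vertex of maximum out-degree\<close>

text \<open>\<open>middle_unique\<close> restates P22-freeness: between distinct endpoints there is
  at most one walk of length two, and looplessness makes the four vertices distinct once u and w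
  differ. The case x = y stays excluded because one vertex may lie on several 2-cycles.\<close>

locale P22_free_digraph =
  fixes V :: "'a set" and A :: "('a \<times> 'a) set"
  assumes finite_V: "finite V" and arcs: "A \<subseteq> V \<times> V" and loopless: "(v, v) \<notin> A"
    and middle_unique: "\<lbrakk>x \<noteq> y; (x, u) \<in> A; (u, y) \<in> A; (x, w) \<in> A; (w, y) \<in> A\<rbrakk> \<Longrightarrow> u = w"
begin

abbreviation N :: "'a \<Rightarrow> 'a set" where "N v \<equiv> A `` {v}"

lemma N_subset: "N v \<subseteq> V"
  using arcs by blast

lemma finite_N [simp]: "finite (N v)"
  using N_subset finite_V finite_subset by blast

lemma N_Int_N_subset:
  assumes "u \<in> N x" "w \<in> N x" "u \<noteq> w"
  shows "N u \<inter> N w \<subseteq> {x}"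
proof
  fix y assume y: "y \<in> N u \<inter> N w"
  show "y \<in> {x}"
  proof (rule ccontr)
    assume "y \<notin> {x}"
    then have "u = w" using assms(1,2) y by (intro middle_unique[of x y]) auto
    then show False using assms(3) by simp
  qed
qed

lemma sum_card_N_Int:
  assumes "X \<subseteq> N x" and "x \<notin> Z"
  shows "(\<Sum>u\<in>X. card (N u \<inter> Z)) = card (\<Union>u\<in>X. N u \<inter> Z)"
proof (rule card_UN_disjoint[symmetric])
  show "finite X" using assms finite_N finite_subset by blast
  show "\<forall>u\<in>X. \<forall>w\<in>X. u \<noteq> w \<longrightarrow> (N u \<inter> Z) \<inter> (N w \<inter> Z) = {}"
  proof (intro ballI impI)
    fix u w assume "u \<in> X" "w \<in> X" "u \<noteq> w"
    then have "N u \<inter> N w \<subseteq> {x}" using assms(1) by (intro N_Int_N_subset) auto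
    then show "(N u \<inter> Z) \<inter> (N w \<inter> Z) = {}" using assms(2) by blast
  qed
qed simp

lemma sum_card_N_Int_le:
  assumes "X \<subseteq> N x" and "x \<notin> Z" and "finite Z"
  shows "(\<Sum>u\<in>X. card (N u \<inter> Z)) \<le> card Z"
  unfolding sum_card_N_Int[OF assms(1,2)] using assms(3) by (intro card_mono) auto

lemma card_A: "card A = (\<Sum>v\<in>V. card (N v))"
proof -
  have "A = (SIGMA v:V. N v)" using arcs by blast
  then show ?thesis using card_SigmaI[OF finite_V, of N] finite_N by simp
qed

end

locale P22_free_digraph_max = P22_free_digraph +
  fixes a :: 'a
  assumes a_in: "a \<in> V" and N_le: "v \<in> V \<Longrightarrow> card (A `` {v}) \<le> card (A `` {a})"
begin

abbreviation S :: "'a set" where "S \<equiv> N a"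
definition T :: "'a set" where "T = V - S"
definition D :: nat where "D = card S"
definition B :: "'a set" where "B = {s \<in> S. (s, a) \<in> A}"
definition R :: "'a set" where "R = V - {a} - (\<Union>s\<in>S. N s)"
text \<open>On \<open>V\<close> the natural subtraction never truncates, since \<open>a\<close> has
  maximum out-degree.\<close>

definition defect :: "'a \<Rightarrow> nat" where "defect v = D - card (N v)"
definition \<Delta> :: nat where "\<Delta> = (\<Sum>t\<in>T. defect t) + card R"
abbreviation k :: "'a \<Rightarrow> nat" where "k v \<equiv> card (N v \<inter> T)"

lemma finite_T [simp]: "finite T" and finite_R [simp]: "finite R"
  using finite_V by (auto simp: T_def R_def)

lemma T_subset: "T \<subseteq> V" and B_subset: "B \<subseteq> S"
  by (auto simp: T_def B_def)

lemma finite_B [simp]: "finite B"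
  using finite_subset[OF B_subset] by simp

lemma a_T: "a \<in> T" and a_notin_S: "a \<notin> S"
  using a_in loopless by (auto simp: T_def)

lemma card_S [simp]: "card S = D"
  by (simp add: D_def)

lemma D_less: "D < card V"
  using a_in loopless psubset_card_mono[OF finite_V, of S] N_subset[of a] unfolding D_def by blast

lemma card_T: "card T = card V - D"
  unfolding T_def D_def using N_subset by (intro card_Diff_subset) auto

lemma pred_in_S:
  assumes "v \<in> V" "v \<noteq> a" "v \<notin> R"
  obtains s where "s \<in> S" "(s, v) \<in> A"
  using assms by (auto simp: R_def)

lemma card_N: "v \<in> V \<Longrightarrow> card (N v) + defect v = D"
  using N_le[of v] by (simp add: defect_def)

lemma card_N_S: "v \<in> V \<Longrightarrow> card (N v \<inter> S) + k v + defect v = D"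
proof -
  assume v: "v \<in> V"
  have "N v = (N v \<inter> S) \<union> (N v \<inter> T)" using N_subset by (auto simp: T_def)
  moreover have "card ((N v \<inter> S) \<union> (N v \<inter> T)) = card (N v \<inter> S) + k v"
    by (rule card_Un_disjoint) (auto simp: T_def)
  ultimately show ?thesis using card_N[OF v] by simp
qed

lemma sum_defect_le:
  assumes "X \<subseteq> T"
  shows "(\<Sum>t\<in>X. defect t) + card R \<le> \<Delta>"
  unfolding \<Delta>_def using assms by (simp add: sum_mono2)

lemma defect_le:
  assumes "t \<in> T"
  shows "defect t + card R \<le> \<Delta>"
  using sum_defect_le[of "{t}"] assms by simp

text \<open>Without \<open>a\<close>, the out-neighbourhoods of the vertices in \<open>S\<close> are
  disjoint and cover all of \<open>V - {a}\<close> except \<open>R\<close>; the arcs into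
  \<open>a\<close> contribute \<open>card B\<close>.\<close>

lemma sum_S: "(\<Sum>s\<in>S. card (N s)) + card R + 1 = card V + card B"
proof -
  have "card (N s) = card (N s \<inter> (V - {a})) + (if s \<in> B then 1 else 0)" if "s \<in> S" for s
  proof (cases "s \<in> B")
    case True
    then have "N s = insert a (N s \<inter> (V - {a}))" using N_subset by (auto simp: B_def)
    then have "card (N s) = card (insert a (N s \<inter> (V - {a})))" by (rule arg_cong)
    then show ?thesis using True by simp
  next
    case False
    then have "N s = N s \<inter> (V - {a})" using that N_subset by (auto simp: B_def)
    then show ?thesis using False by simp
  qed
  then have "(\<Sum>s\<in>S. card (N s)) = (\<Sum>s\<in>S. card (N s \<inter> (V - {a}))) + (\<Sum>s\<in>S. if s \<in> B then 1 else 0)"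
    by (simp add: sum.distrib)
  also have "(\<Sum>s\<in>S. if s \<in> B then 1 else 0) = card B"
    using B_subset by (simp add: sum.If_cases Int_absorb1)
  also have "(\<Sum>s\<in>S. card (N s \<inter> (V - {a}))) = card (\<Union>s\<in>S. N s \<inter> (V - {a}))"
    by (rule sum_card_N_Int) auto
  finally have 1: "(\<Sum>s\<in>S. card (N s)) = card (\<Union>s\<in>S. N s \<inter> (V - {a})) + card B" .
  have "V - {a} = (\<Union>s\<in>S. N s \<inter> (V - {a})) \<union> R" by (auto simp: R_def)
  moreover have "card ((\<Union>s\<in>S. N s \<inter> (V - {a})) \<union> R) = card (\<Union>s\<in>S. N s \<inter> (V - {a})) + card R"
    by (rule card_Un_disjoint) (auto simp: R_def finite_V)
  ultimately have "card (V - {a}) = card (\<Union>s\<in>S. N s \<inter> (V - {a})) + card R" by simp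
  moreover have "card (V - {a}) + 1 = card V"
    using a_in finite_V by (metis Suc_eq_plus1 card_Suc_Diff1)
  ultimately show ?thesis using 1 by simp
qed

lemma arc_count: "card A + \<Delta> + 1 = card V + card B + (card V - D) * D"
proof -
  have "V = S \<union> T" "S \<inter> T = {}" using N_subset by (auto simp: T_def)
  then have "card A = (\<Sum>s\<in>S. card (N s)) + (\<Sum>t\<in>T. card (N t))"
    using card_A sum.union_disjoint[of S T "\<lambda>v. card (N v)"] by simp
  moreover have "(\<Sum>t\<in>T. card (N t)) + (\<Sum>t\<in>T. defect t) = (\<Sum>t\<in>T. D)"
    unfolding sum.distrib[symmetric] using card_N T_subset by (intro sum.cong) auto
  ultimately show ?thesis using sum_S card_T by (simp add: \<Delta>_def)
qed

lemma card_B_le: "card B \<le> D"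
  using card_mono[OF _ B_subset] by simp

text \<open>Two members of \<open>B\<close> in \<open>N t\<close> would be two middle vertices of
  walks from \<open>t\<close> to \<open>a\<close>.\<close>

lemma card_N_B_le:
  assumes "t \<noteq> a"
  shows "card (N t \<inter> B) \<le> 1"
proof -
  have "\<forall>x\<in>N t \<inter> B. \<forall>y\<in>N t \<inter> B. x = y"
    using assms middle_unique[of t a] by (auto simp: B_def)
  then show ?thesis by (simp add: card_le_Suc0_iff_eq)
qed

text \<open>At least \<open>card B - 1\<close> vertices of \<open>S\<close> are missed by
  \<open>t\<close>, and every miss is made up by an arc inside \<open>T\<close> or by the
  defect.\<close>

lemma card_B_bound:
  assumes "t \<in> T" "t \<noteq> a"
  shows "card B \<le> 1 + k t + defect t"
proof -
  have "card (N t \<inter> S) \<le> card ((S - B) \<union> (N t \<inter> B))" by (intro card_mono) auto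
  also have "\<dots> \<le> card (S - B) + card (N t \<inter> B)" by (rule card_Un_le)
  also have "card (S - B) = D - card B"
    using B_subset by (simp add: card_Diff_subset)
  finally have "card (N t \<inter> S) \<le> D - card B + 1" using card_N_B_le[OF assms(2)] by simp
  then show ?thesis using card_N_S[of t] assms T_subset card_B_le by auto
qed

text \<open>This is \<open>arc_count\<close> after completing the square: 4 D (n - D) equals n*n
  minus the square of n - 2D.\<close>

lemma arc_count_square:
  "4 * int (card A) + 4 * int \<Delta> + (int (card V) - 2 * int D)\<^sup>2 =
    (int (card V))\<^sup>2 + 4 * int (card V) + 4 * (int (card B) - 1)"
proof -
  have "int (card A) + int \<Delta> + 1 = int (card V) + int (card B) + (int (card V) - int D) * int D"
    using arg_cong[OF arc_count, of int] D_less by (simp add: of_nat_diff)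
  then show ?thesis unfolding power2_eq_square by (simp only: algebra_simps)
qed

lemma degree_bounds:
  assumes n: "card V \<ge> 13" and big: "(card V)\<^sup>2 + 4 * card V \<le> 4 * card A"
  shows "(\<forall>t\<in>T. k t \<le> 1) \<and> card B \<le> 2 \<and> D + 4 \<le> card V \<and>
    4 * int \<Delta> + (int (card V) - 2 * int D)\<^sup>2 \<le> 4 * (int (card B) - 1)"
proof -
  define n where "n = card V"
  define M where "M = Max (k ` T)"
  have k_le: "k t \<le> M" if "t \<in> T" for t using that by (simp add: M_def)
  have "M \<in> k ` T" unfolding M_def using a_T by (intro Max_in) auto
  then obtain t where t: "t \<in> T" "k t = M" by auto
  have "(int n)\<^sup>2 + 4 * int n \<le> 4 * int (card A)"
    using of_nat_mono[OF big, where 'a = int] unfolding n_def by simp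
  then have square: "4 * int \<Delta> + (int n - 2 * int D)\<^sup>2 \<le> 4 * (int (card B) - 1)"
    using arc_count_square unfolding n_def[symmetric] by linarith
  \<comment> \<open>\<open>card_B_bound\<close> is summed over the n - D - 1 vertices of
    \<open>T - {a}\<close>.\<close>
  have miss: "(int n - int D - 1) * (int (card B) - 1) \<le> (int n - int D - 1) * int M + int \<Delta>"
  proof -
    have "(\<Sum>t\<in>T-{a}. int (card B) - 1) \<le> (\<Sum>t\<in>T-{a}. int M + int (defect t))"
    proof (rule sum_mono)
      fix t assume "t \<in> T - {a}"
      then show "int (card B) - 1 \<le> int M + int (defect t)"
        using card_B_bound[of t] k_le[of t] by auto
    qed
    moreover have "(\<Sum>t\<in>T-{a}. defect t) \<le> \<Delta>" using sum_defect_le[of "T - {a}"] by auto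
    then have "(\<Sum>t\<in>T-{a}. int (defect t)) \<le> int \<Delta>" by (simp flip: of_nat_sum)
    moreover have "int (card (T - {a})) = int n - int D - 1"
      using a_T D_less by (simp add: card_T n_def of_nat_diff)
    ultimately show ?thesis by (simp add: sum.distrib)
  qed
  let ?X = "N t \<inter> T"
  have sum_D: "(\<Sum>u\<in>?X. D) = M * D" using t by simp
  have sum_defect: "(\<Sum>u\<in>?X. defect u) \<le> \<Delta>" using sum_defect_le[of ?X] by auto
  \<comment> \<open>The \<open>M\<close> out-neighbours of \<open>t\<close> in \<open>T\<close> have
    out-neighbourhoods that are disjoint apart from \<open>t\<close>; dropping \<open>t\<close>
    costs at most one for each, which is the summand \<open>M\<close>.\<close>
  have out_all: "M * D \<le> n - 1 + \<Delta> + M"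
  proof -
    have "D \<le> card (N u \<inter> (V - {t})) + defect u + 1" if "u \<in> ?X" for u
    proof -
      have "card (N u) \<le> card (insert t (N u \<inter> (V - {t})))"
        using N_subset by (intro card_mono) auto
      also have "\<dots> \<le> card (N u \<inter> (V - {t})) + 1" using card_insert_le_m1 by (simp add: card_insert_if)
      finally show ?thesis using card_N[of u] that T_subset by auto
    qed
    then have "(\<Sum>u\<in>?X. D) \<le> (\<Sum>u\<in>?X. card (N u \<inter> (V - {t})) + defect u + 1)" by (rule sum_mono)
    also have "\<dots> = (\<Sum>u\<in>?X. card (N u \<inter> (V - {t}))) + (\<Sum>u\<in>?X. defect u) + M"
      using t by (simp only: sum.distrib card_eq_sum)
    also have "(\<Sum>u\<in>?X. card (N u \<inter> (V - {t}))) \<le> card (V - {t})"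
      using finite_V by (intro sum_card_N_Int_le) auto
    also have "card (V - {t}) = n - 1" using t T_subset by (auto simp: n_def card_Diff_singleton)
    finally show ?thesis using sum_D sum_defect by linarith
  qed
  \<comment> \<open>The same disjointness inside \<open>S\<close>, which does not contain
    \<open>t\<close>: each of these out-neighbours sends all but at most \<open>M\<close> of its
    arcs into \<open>S\<close>.\<close>
  have out_S: "M * D \<le> D + M * M + \<Delta>"
  proof -
    have "D \<le> card (N u \<inter> S) + M + defect u" if "u \<in> ?X" for u
    proof -
      have "u \<in> V" "k u \<le> M" using that T_subset k_le by auto
      then show ?thesis using card_N_S[of u] by linarith
    qed
    then have "(\<Sum>u\<in>?X. D) \<le> (\<Sum>u\<in>?X. card (N u \<inter> S) + M + defect u)" by (rule sum_mono)
    also have "\<dots> = (\<Sum>u\<in>?X. card (N u \<inter> S)) + M * M + (\<Sum>u\<in>?X. defect u)"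
      using t by (simp add: sum.distrib)
    also have "(\<Sum>u\<in>?X. card (N u \<inter> S)) \<le> card S"
      using t by (intro sum_card_N_Int_le) (auto simp: T_def)
    finally show ?thesis using sum_D sum_defect card_S by linarith
  qed
  have "int M \<le> 1 \<and> int (card B) \<le> 2 \<and> int D + 4 \<le> int n"
  proof (rule degree_arithmetic[where \<Delta> = "int \<Delta>"])
    have pred: "int (n - 1) = int n - 1" using n by (simp add: n_def of_nat_diff)
    show "int M * int D \<le> int n - 1 + int \<Delta> + int M"
      using of_nat_mono[OF out_all, where 'a = int] by (simp only: of_nat_mult of_nat_add pred)
    show "int M * int D \<le> int D + int M * int M + int \<Delta>"
      using of_nat_mono[OF out_S, where 'a = int] by (simp only: of_nat_mult of_nat_add)
    show "4 * int \<Delta> + (int n - 2 * int D)\<^sup>2 \<le> 4 * (int (card B) - 1)" by (rule square)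
    show "(int n - int D - 1) * (int (card B) - 1) \<le> (int n - int D - 1) * int M + int \<Delta>"
      by (rule miss)
    show "int n \<ge> 13" using n by (simp add: n_def)
    show "int (card B) \<le> int D" using card_B_le by simp
  qed simp_all
  then have "M \<le> 1" "card B \<le> 2" "D + 4 \<le> card V" by (simp_all add: n_def)
  then show ?thesis using k_le square unfolding n_def by (meson le_trans)
qed

section \<open>Vertices with nearly all of S as out-neighbours\<close>

text \<open>Two out-neighbours of \<open>s\<close> share no out-neighbour but \<open>s\<close>, yet
  each has at least D - 2 in \<open>S\<close>. This would give 2(D - 2) \<le> D + 1, which fails
  from D = 6 on.\<close>

lemma card_N_Int_le_1:
  assumes s: "s \<in> S" and "6 \<le> D" and X: "\<And>v. v \<in> X \<Longrightarrow> D \<le> card (N v \<inter> S) + 2"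
  shows "card (N s \<inter> X) \<le> 1"
proof -
  have "v = w" if v: "v \<in> N s \<inter> X" and w: "w \<in> N s \<inter> X" for v w
  proof (rule ccontr)
    assume "v \<noteq> w"
    have "N v \<inter> N w \<inter> S \<subseteq> {s}"
      using N_Int_N_subset[of v s w] v w \<open>v \<noteq> w\<close> by blast
    then have "card (N v \<inter> N w \<inter> S) \<le> 1" using card_mono[of "{s}"] by simp
    moreover have "card ((N v \<inter> S) \<union> (N w \<inter> S)) \<le> card S" by (intro card_mono) auto
    moreover have "(N v \<inter> S) \<inter> (N w \<inter> S) = N v \<inter> N w \<inter> S" by blast
    then have "card (N v \<inter> S) + card (N w \<inter> S) =
        card ((N v \<inter> S) \<union> (N w \<inter> S)) + card (N v \<inter> N w \<inter> S)"
      using card_Un_Int[of "N v \<inter> S" "N w \<inter> S"] by simp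
    moreover have "D \<le> card (N v \<inter> S) + 2" "D \<le> card (N w \<inter> S) + 2" using X v w by auto
    ultimately show False using \<open>6 \<le> D\<close> card_S by linarith
  qed
  then show ?thesis by (auto simp: card_le_Suc0_iff_eq)
qed

text \<open>Each vertex of \<open>X\<close> reaches at most one vertex of \<open>W\<close>, so
  reaching all of \<open>W\<close> takes at least \<open>card W\<close> vertices.\<close>

lemma card_reached_le:
  assumes "X \<subseteq> S" "6 \<le> D" and "\<And>v. v \<in> W \<Longrightarrow> D \<le> card (N v \<inter> S) + 2"
    and "\<And>v. v \<in> W \<Longrightarrow> \<exists>s\<in>X. (s, v) \<in> A"
  shows "card W \<le> card X"
proof -
  have fin: "finite X" using assms(1) finite_subset finite_N by blast
  have "W \<subseteq> (\<Union>s\<in>X. N s \<inter> W)" using assms(4) by blast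
  then have "card W \<le> card (\<Union>s\<in>X. N s \<inter> W)" using fin by (intro card_mono) auto
  also have "\<dots> \<le> (\<Sum>s\<in>X. card (N s \<inter> W))" using fin by (rule card_UN_le)
  also have "\<dots> \<le> (\<Sum>s\<in>X. 1)" using assms(1,2,3) card_N_Int_le_1 by (intro sum_mono) blast
  finally show ?thesis by simp
qed

lemma card_N_S_ge:
  assumes "\<forall>t\<in>T. k t \<le> 1" and "v \<in> T"
  shows "D + card R \<le> card (N v \<inter> S) + 1 + \<Delta>"
proof -
  have "card (N v \<inter> S) + k v + defect v = D" using card_N_S assms T_subset by blast
  moreover have "k v \<le> 1" "defect v + card R \<le> \<Delta>" using assms defect_le by auto
  ultimately show ?thesis by linarith
qed

text \<open>Since b sends arcs to almost all of S, it behaves like a vertex outside S: the digraph then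
  looks like the complete bipartite digraph from T + b to S - b with few further arcs.\<close>

lemma hub:
  assumes k1: "\<forall>t\<in>T. k t \<le> 1" and t: "t \<in> T" "k t = 1" "defect t = 0"
  obtains b u where "b \<in> S" "N t \<inter> S = S - {b}" "N t \<inter> T = {u}" "N u \<inter> S - R \<subseteq> N b"
    "D \<le> card (N b \<inter> S) + 1 + \<Delta>"
proof -
  have "card (N t \<inter> S) + 1 = card S" using card_N_S[of t] t T_subset by auto
  then have "card (S - N t) = 1"
    using card_Diff_subset_Int[of S "N t"] by (simp add: Int_commute)
  then obtain b where b: "S - N t = {b}" by (auto simp: card_1_singleton_iff)
  obtain u where u: "N t \<inter> T = {u}" using t(2) by (auto simp: card_1_singleton_iff)
  \<comment> \<open>Such an \<open>s\<close> has a predecessor in \<open>S\<close>. If it were not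
    \<open>b\<close>, then \<open>t\<close> would reach \<open>s\<close> both through it and through
    \<open>u\<close>, and these differ because \<open>u\<close> lies in \<open>T\<close>.\<close>
  have sub: "N u \<inter> S - R \<subseteq> N b"
  proof
    fix s assume s: "s \<in> N u \<inter> S - R"
    then have "s \<in> V" "s \<noteq> a" "s \<notin> R" using N_subset a_notin_S by auto
    then obtain s' where s': "s' \<in> S" "(s', s) \<in> A" by (rule pred_in_S)
    have "s' = b"
    proof (rule ccontr)
      assume "s' \<noteq> b"
      then have "(t, s') \<in> A" using b s' by blast
      moreover have "(t, u) \<in> A" "t \<noteq> s" "s' \<noteq> u" using u s s' t by (auto simp: T_def)
      ultimately show False using middle_unique[of t s s' u] s s' by auto
    qed
    then show "s \<in> N b" using s' by simp
  qed
  have "u \<in> T" using u by blast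
  have "card (N u \<inter> S) \<le> card ((N b \<inter> S) \<union> R)" using sub by (intro card_mono) auto
  also have "\<dots> \<le> card (N b \<inter> S) + card R" by (rule card_Un_le)
  finally have "D \<le> card (N b \<inter> S) + 1 + \<Delta>"
    using card_N_S_ge[OF k1 \<open>u \<in> T\<close>] by linarith
  moreover have "b \<in> S" "N t \<inter> S = S - {b}" using b by auto
  ultimately show thesis using that u sub by blast
qed

lemma missed_in_B:
  assumes "card B = 2" "t \<noteq> a" "N t \<inter> S = S - {b}"
  shows "b \<in> B"
proof -
  have "\<not> B \<subseteq> N t"
  proof
    assume "B \<subseteq> N t"
    then have "N t \<inter> B = B" by blast
    then show False using card_N_B_le[OF assms(2)] assms(1) by simp
  qed
  then show ?thesis using assms(3) B_subset by blast
qed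

text \<open>If \<open>b\<close> had an arc to \<open>v\<close>, every out-neighbour s of
  \<open>v\<close> in \<open>S\<close> other than \<open>b\<close> would be reached from
  \<open>b\<close> both through \<open>v\<close> and through \<open>a\<close>.\<close>

lemma B_no_arc:
  assumes "b \<in> B" "v \<noteq> a" "1 < card (N v \<inter> S)"
  shows "(b, v) \<notin> A"
proof
  assume "(b, v) \<in> A"
  have "\<not> N v \<inter> S \<subseteq> {b}" using assms(3) card_mono[of "{b}" "N v \<inter> S"] by auto
  then obtain s where "s \<in> S" "(v, s) \<in> A" "s \<noteq> b" by blast
  then show False using middle_unique[of b s v a] \<open>(b, v) \<in> A\<close> assms by (auto simp: B_def)
qed

section \<open>Constraints when two or one arcs return to a from S\<close>

text \<open>The hub \<open>b\<close> lies in \<open>B\<close>, so it has no arc to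
  \<open>T - {a}\<close>, while \<open>a\<close> is also reached from the other vertex of
  \<open>B\<close>. Hence \<open>S - {b}\<close> alone reaches all of \<open>insert b T - R\<close>,
  and \<open>card_reached_le\<close> compares the sizes D - 1 and at least n - D + 1 - card
  R.\<close>

lemma two_back_arcs:
  assumes k1: "\<forall>t\<in>T. k t \<le> 1" and B2: "card B = 2" and \<Delta>: "\<Delta> \<le> 1" and D: "6 \<le> D" "D + 4 \<le> card V"
  shows "card V + 2 \<le> 2 * D + card R"
proof -
  have "\<exists>t\<in>T - {a}. defect t = 0"
  proof (rule ccontr)
    assume "\<not> (\<exists>t\<in>T - {a}. defect t = 0)"
    then have "(\<Sum>t\<in>T-{a}. 1) \<le> (\<Sum>t\<in>T-{a}. defect t)" by (intro sum_mono) (auto simp: Suc_le_eq)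
    also have "\<dots> \<le> \<Delta>" using sum_defect_le[of "T - {a}"] by auto
    finally have "card (T - {a}) \<le> \<Delta>" by simp
    then show False using a_T card_T \<Delta> D by simp
  qed
  then obtain t where t: "t \<in> T" "t \<noteq> a" "defect t = 0" by blast
  then have kt: "k t = 1" using card_B_bound[of t] B2 k1 by force
  obtain b u where b: "b \<in> S" "N t \<inter> S = S - {b}" "D \<le> card (N b \<inter> S) + 1 + \<Delta>"
    using hub[OF k1 t(1) kt t(3)] by metis
  have bB: "b \<in> B" using missed_in_B B2 t(2) b(2) .
  have "card (B - {b}) = 1" using B2 bB by simp
  then obtain b' where b': "b' \<in> B" "b' \<noteq> b" by (metis Diff_iff card_1_singletonE insertI1)
  have out: "D \<le> card (N v \<inter> S) + 2" if "v \<in> insert b T" for v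
    using that b(3) \<Delta> card_N_S_ge[OF k1, of v] by auto
  have b_out: "(b, v) \<notin> A" if v: "v \<in> T - {a}" for v
    using B_no_arc[OF bB, of v] out[of v] v D by auto
  have "card (insert b T - R) \<le> card (S - {b})"
  proof (rule card_reached_le)
    fix v assume v: "v \<in> insert b T - R"
    show "D \<le> card (N v \<inter> S) + 2" using out v by blast
    show "\<exists>s\<in>S - {b}. (s, v) \<in> A"
    proof (cases "v = a")
      case True
      then show ?thesis using b' B_subset by (auto simp: B_def)
    next
      case False
      then obtain s where "s \<in> S" "(s, v) \<in> A"
        using pred_in_S[of v] v b T_subset N_subset by blast
      then show ?thesis using b_out[of v] v False loopless by blast
    qed
  qed (use D in auto)
  moreover have "card (insert b T) \<le> card (insert b T - R) + card R"
  proof -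
    have "card (insert b T) \<le> card ((insert b T - R) \<union> R)" by (intro card_mono) auto
    then show ?thesis using card_Un_le[of "insert b T - R" R] by linarith
  qed
  moreover have "card (insert b T) = card V - D + 1"
  proof -
    have "b \<notin> T" using b(1) by (simp add: T_def)
    then show ?thesis using card_T by simp
  qed
  ultimately show ?thesis using b(1) D by simp
qed

text \<open>Each vertex of \<open>T - {a}\<close> has exactly one out-neighbour in \<open>T\<close>,
  and this map turns out to be a fixed-point-free involution of \<open>T - {a}\<close>.\<close>

lemma two_back_arcs_even:
  assumes k1: "\<forall>t\<in>T. k t \<le> 1" and B2: "card B = 2" and \<Delta>: "\<Delta> = 0" and D: "6 \<le> D"
  shows "even (card (T - {a}))"
proof -
  have R0: "R = {}" and def0: "\<And>t. t \<in> T \<Longrightarrow> defect t = 0" using \<Delta> by (auto simp: \<Delta>_def)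
  have kt: "k t = 1" if "t \<in> T - {a}" for t
    using card_B_bound[of t] B2 k1 def0[of t] that by force
  define f where "f t = (THE u. N t \<inter> T = {u})" for t
  have f: "N t \<inter> T = {f t}" if t: "t \<in> T - {a}" for t
  proof -
    obtain u where "N t \<inter> T = {u}" using kt[OF t] by (auto simp: card_1_singleton_iff)
    then show ?thesis unfolding f_def by (metis (mono_tags) the_equality singleton_inject)
  qed
  have hubT: "\<exists>b\<in>S. N t \<inter> S = S - {b} \<and> N (f t) \<inter> S \<subseteq> N b \<and> D \<le> card (N b \<inter> S) + 1 + \<Delta>"
    if t: "t \<in> T - {a}" for t
  proof -
    have t': "t \<in> T" "defect t = 0" using t def0 by auto
    obtain b u where b: "b \<in> S" "N t \<inter> S = S - {b}" "N t \<inter> T = {u}" "N u \<inter> S - R \<subseteq> N b"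
      "D \<le> card (N b \<inter> S) + 1 + \<Delta>"
      using hub[OF k1 t'(1) kt[OF t] t'(2)] by blast
    have "u = f t" using f[OF t] b(3) by simp
    then have "N (f t) \<inter> S \<subseteq> N b" using b(4) R0 by simp
    then show ?thesis using b(1,2,5) by (intro bexI[of _ b]) simp_all
  qed
  have fT: "f t \<in> T - {a}" if t: "t \<in> T - {a}" for t
  proof -
    obtain b where b: "b \<in> S" "N (f t) \<inter> S \<subseteq> N b" using hubT[OF t] by blast
    \<comment> \<open>If \<open>f t\<close> were \<open>a\<close>, all of \<open>S\<close> would lie
      in \<open>N b\<close>, giving a loop at \<open>b\<close>.\<close>
    have "f t \<noteq> a" using b loopless by auto
    then show ?thesis using f[OF t] by blast
  qed
  have ff: "f (f t) = t" if t: "t \<in> T - {a}" for t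
  proof (rule ccontr)
    assume "f (f t) \<noteq> t"
    let ?v = "f (f t)"
    have v: "?v \<in> T - {a}" using fT t by blast
    obtain s where s: "s \<in> S" "(s, ?v) \<in> A" using pred_in_S[of ?v] v R0 T_subset by blast
    obtain b where b: "N t \<inter> S = S - {b}" using hubT[OF t] by blast
    have "b \<in> B" using missed_in_B[OF B2 _ b] t by blast
    \<comment> \<open>Hence \<open>t\<close> has an arc to \<open>s\<close> and reaches
      \<open>?v\<close> both through \<open>s\<close> in \<open>S\<close> and through
      \<open>f t\<close> in \<open>T\<close>.\<close>
    then have "s \<noteq> b" using B_no_arc[of b ?v] card_N_S_ge[OF k1, of ?v] v s \<Delta> D by auto
    then have ts: "(t, s) \<in> A" using s b by blast
    have "(t, f t) \<in> A" "(f t, ?v) \<in> A" "f t \<in> T" using f[OF t] f[OF fT[OF t]] by auto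
    then have "s = f t" using middle_unique[of t ?v s "f t"] ts s \<open>?v \<noteq> t\<close> by auto
    then show False using \<open>f t \<in> T\<close> s by (auto simp: T_def)
  qed
  show ?thesis
  proof (rule even_card_involution[of _ f])
    show "f t \<noteq> t" if "t \<in> T - {a}" for t
    proof -
      have "(t, f t) \<in> A" using f[OF that] by blast
      then show ?thesis using loopless by metis
    qed
  qed (simp, erule fT, erule ff)
qed

text \<open>Here \<open>T\<close> has no inner arcs and every vertex of \<open>T\<close> has
  out-neighbourhood \<open>S\<close>. Choosing for each vertex of \<open>S\<close> a predecessor in
  \<open>S\<close> then gives a fixed-point-free involution of \<open>S\<close>.\<close>

lemma one_back_arc:
  assumes k1: "\<forall>t\<in>T. k t \<le> 1" and B1: "card B = 1" and \<Delta>: "\<Delta> = 0"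
    and D: "6 \<le> D" "card V = 2 * D"
  shows "even D"
proof -
  have R0: "R = {}" and def0: "\<And>t. t \<in> T \<Longrightarrow> defect t = 0" using \<Delta> by (auto simp: \<Delta>_def)
  have reached: "\<exists>s\<in>S. (s, v) \<in> A" if "v \<in> V" for v
  proof (cases "v = a")
    case True
    then show ?thesis using B1 by (auto simp: card_1_singleton_iff B_def)
  next
    case False
    then show ?thesis using that pred_in_S[of v] R0 by blast
  qed
  have out: "D \<le> card (N v \<inter> S) + 2" if "v \<in> T" for v
    using that \<Delta> card_N_S_ge[OF k1, of v] by auto
  have k0: "k t = 0" if t: "t \<in> T" for t
  proof (rule ccontr)
    assume "k t \<noteq> 0"
    then have "k t = 1" using k1 t by force
    then obtain b where b: "b \<in> S" "D \<le> card (N b \<inter> S) + 1 + \<Delta>"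
      using hub[OF k1 t _ def0[OF t]] by metis
    have "b \<in> V" using b N_subset by blast
    then have kb: "k b \<le> 1" using card_N_S[of b] b \<Delta> by linarith
    \<comment> \<open>The hub has at most one arc into \<open>T\<close>, so
      \<open>insert b T - N b\<close> has at least \<open>D\<close> vertices, too many to be reached
      from the \<open>D - 1\<close> vertices of \<open>S - {b}\<close>.\<close>
    have "card (insert b T - N b) \<le> card (S - {b})"
    proof (rule card_reached_le)
      fix v assume v: "v \<in> insert b T - N b"
      then show "D \<le> card (N v \<inter> S) + 2" using out b \<Delta> by auto
      show "\<exists>s\<in>S - {b}. (s, v) \<in> A" using reached[of v] v \<open>b \<in> V\<close> T_subset by blast
    qed (use D in auto)
    moreover have "card (insert b T) \<le> card (insert b T - N b) + k b"
    proof -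
      have "insert b T \<subseteq> (insert b T - N b) \<union> (N b \<inter> T)" using loopless by auto
      then have "card (insert b T) \<le> card ((insert b T - N b) \<union> (N b \<inter> T))"
        by (intro card_mono) auto
      then show ?thesis using card_Un_le[of "insert b T - N b" "N b \<inter> T"] by linarith
    qed
    moreover have "card (insert b T) = D + 1"
    proof -
      have "b \<notin> T" using b(1) by (simp add: T_def)
      then show ?thesis using card_T D by simp
    qed
    ultimately show False using b(1) D kb by simp
  qed
  have NT: "N t = S" if t: "t \<in> T" for t
  proof -
    have "card (N t \<inter> S) = card S" using card_N_S[of t] k0[OF t] def0[OF t] t T_subset by auto
    then have "N t \<inter> S = S" by (intro card_subset_eq) auto
    moreover have "N t \<inter> T = {}" using k0[OF t] by simp
    ultimately show ?thesis using N_subset[of t] unfolding T_def by blast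
  qed
  have S_to_T: "\<exists>t\<in>T. (s, t) \<in> A" if s: "s \<in> S" for s
  proof (rule ccontr)
    assume no: "\<not> (\<exists>t\<in>T. (s, t) \<in> A)"
    have "card T \<le> card (S - {s})"
    proof (rule card_reached_le)
      fix v assume v: "v \<in> T"
      show "D \<le> card (N v \<inter> S) + 2" using out v .
      show "\<exists>s'\<in>S - {s}. (s', v) \<in> A" using reached[of v] no v T_subset by blast
    qed (use D in auto)
    then show False using s D card_T by simp
  qed
  define g where "g s = (SOME s'. s' \<in> S \<and> (s', s) \<in> A)" for s
  have g: "g s \<in> S" "(g s, s) \<in> A" if "s \<in> S" for s
    using someI_ex[of "\<lambda>s'. s' \<in> S \<and> (s', s) \<in> A"] reached[of s] that N_subset
    unfolding g_def by blast+
  have gg: "g (g s) = s" if s: "s \<in> S" for s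
  proof (rule ccontr)
    assume "g (g s) \<noteq> s"
    \<comment> \<open>From \<open>g (g s)\<close> the vertex \<open>s\<close> is reached through
      \<open>g s\<close> in \<open>S\<close> and also through \<open>t\<close> in
      \<open>T\<close>.\<close>
    obtain t where t: "t \<in> T" "(g (g s), t) \<in> A" using S_to_T g s by blast
    have "(t, s) \<in> A" using NT[OF t(1)] s by blast
    then have "t = g s" using middle_unique[OF \<open>g (g s) \<noteq> s\<close> t(2)] g s by blast
    then show False using t g s by (auto simp: T_def)
  qed
  have "even (card S)"
    by (rule even_card_involution[of _ g]) (use g gg loopless in \<open>auto, metis\<close>)
  then show ?thesis by simp
qed

end

section \<open>The two bounds\<close>

lemma middle_unique_if_P22_free:
  assumes "strict_digraph V A" "P22_free A" "x \<noteq> y" "(x, u) \<in> A" "(u, y) \<in> A" "(x, w) \<in> A" "(w, y) \<in> A"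
  shows "u = w"
proof (rule ccontr)
  assume "u \<noteq> w"
  moreover have "x \<noteq> u" "x \<noteq> w" "u \<noteq> y" "w \<noteq> y" using assms unfolding strict_digraph_def by blast+
  ultimately have "distinct [x, u, w, y]" using assms(3) by auto
  then show False using assms unfolding P22_free_def contains_P22_def by blast
qed

lemma card_arcs_le:
  fixes A :: "('a \<times> 'a) set"
  assumes "finite V" "strict_digraph V A" "P22_free A" and n: "card V = n" "13 \<le> n"
  shows "4 * card A \<le> (if odd n then n\<^sup>2 + 4 * n - 1
                     else if even (n div 2) then n\<^sup>2 + 4 * n
                     else n\<^sup>2 + 4 * n - 4)"
proof (rule ccontr)
  assume "\<not> ?thesis"
  then have large: "(if odd n then n\<^sup>2 + 4 * n - 1 else if even (n div 2) then n\<^sup>2 + 4 * n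
      else n\<^sup>2 + 4 * n - 4) < 4 * card A" by simp
  let ?M = "Max ((\<lambda>v. card (A `` {v})) ` V)"
  have "V \<noteq> {}" using n by auto
  then have "?M \<in> (\<lambda>v. card (A `` {v})) ` V" using assms(1) by (intro Max_in) auto
  then obtain a where "a \<in> V" "card (A `` {a}) = ?M" by auto
  then have a: "a \<in> V \<and> (\<forall>v. v \<in> V \<longrightarrow> card (A `` {v}) \<le> card (A `` {a}))"
    using assms(1) by simp
  interpret P22_free_digraph_max V A a
  proof
    show "A \<subseteq> V \<times> V" "\<And>v. (v, v) \<notin> A" using assms(2) by (auto simp: strict_digraph_def)
    show "\<And>x y u w. \<lbrakk>x \<noteq> y; (x, u) \<in> A; (u, y) \<in> A; (x, w) \<in> A; (w, y) \<in> A\<rbrakk> \<Longrightarrow> u = w"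
      by (rule middle_unique_if_P22_free[OF assms(2,3)])
  qed (use a assms(1) in auto)
  \<comment> \<open>For even \<open>n\<close> both sides are multiples of 4, so exceeding n*n + 4n -
    4 already means reaching n*n + 4n.\<close>
  have big: "n\<^sup>2 + 4 * n \<le> 4 * card A"
  proof (cases "odd n")
    case True
    then show ?thesis using large by simp
  next
    case False
    then obtain m where "n = 2 * m" by blast
    then show ?thesis using large by (auto simp: power2_eq_square split: if_splits) presburger
  qed
  have k1: "\<forall>t\<in>T. k t \<le> 1" and B2: "card B \<le> 2" and Dn: "D + 4 \<le> n"
    and sq: "4 * int \<Delta> + (int n - 2 * int D)\<^sup>2 \<le> 4 * (int (card B) - 1)"
    using degree_bounds n big by auto
  define q where "q = (int n - 2 * int D)\<^sup>2"
  have q0: "0 \<le> q" by (simp add: q_def)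
  have sq': "4 * int \<Delta> + q + 4 \<le> 4 * int (card B)" using sq by (simp add: q_def)
  have "q \<le> 2\<^sup>2" using sq' B2 by simp
  then have close: "int n - 2 * int D \<le> 2" "2 * int D - int n \<le> 2"
    using power2_le_imp_le[of "int n - 2 * int D" 2] power2_le_imp_le[of "2 * int D - int n" 2]
    by (simp_all add: q_def power2_commute)
  then have D6: "6 \<le> D" using n by linarith
  have "1 \<le> card B" using sq' q0 by linarith
  then consider "card B = 1" | "card B = 2" using B2 by linarith
  then show False
  proof cases
    case 1
    then have \<Delta>: "\<Delta> = 0" using sq' q0 by linarith
    have "q = 0" using 1 sq' q0 by linarith
    then have nD: "n = 2 * D" by (simp add: q_def)
    then have "even D" using one_back_arc[OF k1 1 \<Delta> D6] n by simp
    moreover have "int (4 * card A) = int (n\<^sup>2 + 4 * n)"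
      using arc_count_square 1 \<Delta> nD n by simp
    ultimately show False using large nD by (simp only: of_nat_eq_iff) simp
  next
    case 2
    have "card R \<le> \<Delta>" by (simp add: \<Delta>_def)
    moreover have "\<Delta> \<le> 1" using sq' 2 q0 by linarith
    moreover have "n + 2 \<le> 2 * D + card R"
      using two_back_arcs[OF k1 2 \<open>\<Delta> \<le> 1\<close> D6] n Dn by simp
    moreover have "n = 2 * D" if "\<Delta> = 1"
    proof -
      have "q = 0" using sq' 2 that q0 by linarith
      then show ?thesis by (simp add: q_def)
    qed
    \<comment> \<open>\<open>\<Delta> = 1\<close> would force \<open>n = 2 * D\<close> and then
      \<open>card R \<ge> 2\<close>, more than \<Delta> allows. So \<open>R\<close> is empty, and
      \<open>close\<close> turns \<open>n + 2 \<le> 2 * D\<close> into an equality.\<close>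
    ultimately have \<Delta>: "\<Delta> = 0" and nD: "n + 2 = 2 * D"
      using close by linarith+
    have "int n - 2 * int D = - 2" using nD by linarith
    then have "int (4 * card A) = int (n\<^sup>2 + 4 * n)"
      using arc_count_square 2 \<Delta> n by simp
    then have "4 * card A = n\<^sup>2 + 4 * n" by (simp only: of_nat_eq_iff)
    moreover have "card (T - {a}) = D - 3" using a_T card_T n nD by simp
    then have "odd D" using two_back_arcs_even[OF k1 2 \<Delta> D6] D6 by simp
    moreover have "n = 2 * (D - 1)" using nD by simp
    ultimately show False using large D6 by simp
  qed
qed

section \<open>Digraphs attaining the bound\<close>

text \<open>A vertex i below \<open>p\<close> reaches y < q through \<open>p + y\<close>, and it
  reaches \<open>f (f i)\<close> through \<open>f i\<close>. Condition \<open>ff\<close> lets these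
  walks share an end only if it is i itself. Every vertex from \<open>p\<close> on has out-degree
  one.\<close>

lemma P22_free_example:
  fixes p q :: nat and f :: "nat \<Rightarrow> nat"
  assumes "q \<le> p" and f: "\<And>i. i < p \<Longrightarrow> f i < p" "\<And>i. i < p \<Longrightarrow> f i \<noteq> i"
    and ff: "\<And>i. i < p \<Longrightarrow> f (f i) < q \<Longrightarrow> f (f i) = i"
  shows "\<exists>A. strict_digraph {..<p + q} A \<and> P22_free A \<and> card A = p * q + p + q"
proof -
  define A1 where "A1 = {..<p} \<times> {p..<p + q}"
  define A2 where "A2 = (\<lambda>i. (i, f i)) ` {..<p}"
  define A3 where "A3 = (\<lambda>j. (p + j, j)) ` {..<q}"
  define A where "A = A1 \<union> A2 \<union> A3"
  have A: "(x, y) \<in> A \<longleftrightarrow> x < p \<and> p \<le> y \<and> y < p + q \<or> x < p \<and> y = f x \<or> x = p + y \<and> y < q" for x y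
    by (auto simp: A_def A1_def A2_def A3_def)
  have "strict_digraph {..<p + q} A"
    using assms(1) f unfolding strict_digraph_def by (auto simp: A) (fastforce dest: f)+
  moreover have "u = w" if xy: "x \<noteq> y" and walk: "(x, u) \<in> A" "(u, y) \<in> A" "(x, w) \<in> A" "(w, y) \<in> A" for x y u w
  proof -
    show ?thesis
    proof (cases "x < p")
      case True
      have "v = f x" if "p \<le> y" "(x, v) \<in> A" "(v, y) \<in> A" for v
        using that True assms(1) by (auto simp: A)
      moreover have "v = f x \<and> y = f (f x) \<or> v = p + y \<and> y < q"
        if "y < p" "(x, v) \<in> A" "(v, y) \<in> A" for v
        using that True f(1)[OF True] by (auto simp: A)
      ultimately show ?thesis using walk xy ff[OF True] by (metis not_less)
    next
      case False
      then show ?thesis using walk by (auto simp: A)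
    qed
  qed
  then have "P22_free A" unfolding P22_free_def contains_P22_def by fastforce
  moreover have "card A = p * q + p + q"
  proof -
    have "\<not> p \<le> f i" if "i < p" for i using f(1)[OF that] by simp
    then have "A1 \<inter> A2 = {}" "(A1 \<union> A2) \<inter> A3 = {}"
      by (auto simp: A1_def A2_def A3_def)
    moreover have "card A2 = p" "card A3 = q"
      unfolding A2_def A3_def by (simp_all add: card_image inj_on_def)
    moreover have "finite A1" "finite A2" "finite A3" by (simp_all add: A1_def A2_def A3_def)
    ultimately show ?thesis unfolding A_def by (simp add: card_Un_disjoint A1_def)
  qed
  ultimately show ?thesis by blast
qed

lemma P22_free_example_less:
  assumes "q < p" "2 \<le> p"
  shows "\<exists>A. strict_digraph {..<p + q} A \<and> P22_free A \<and> card A = p * q + p + q"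
  \<comment> \<open>Only \<open>p - 2\<close> and \<open>p - 1\<close> are values of
    \<open>f\<close>. They are swapped, and any other i has \<open>f (f i) = p - 1\<close>, which is
    at least \<open>q\<close>.\<close>
  by (rule P22_free_example[where f = "\<lambda>i. if i = p - 2 then p - 1 else p - 2"])
    (use assms in \<open>auto split: if_splits\<close>)

text \<open>Equal sides leave no vertex of P outside the matching, so \<open>f\<close> has to be an
  involution; swapping 2j and 2j + 1 needs \<open>p\<close> even.\<close>

lemma P22_free_example_even:
  assumes "even p"
  shows "\<exists>A. strict_digraph {..<p + p} A \<and> P22_free A \<and> card A = p * p + p + p"
proof (rule P22_free_example[where f = "\<lambda>i. if even i then i + 1 else i - 1"])
  show "(if even i then i + 1 else i - 1) < p" if "i < p" for i
    using that assms by (auto elim!: evenE oddE)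
  show "(if even i then i + 1 else i - 1) \<noteq> i" for i
    by (auto elim: oddE)
qed auto

lemma extremal_digraph:
  assumes n: "13 \<le> n"
  shows "\<exists>A. strict_digraph {..<n} A \<and> P22_free A \<and>
    4 * card A = (if odd n then n\<^sup>2 + 4 * n - 1
                     else if even (n div 2) then n\<^sup>2 + 4 * n
                     else n\<^sup>2 + 4 * n - 4)"
proof -
  \<comment> \<open>When n/2 is odd, equal sides would need a fixed-point-free involution on an odd
    set; the sizes m + 2 and m are used instead, where the product loses one.\<close>
  consider (odd) m where "n = (m + 1) + m" "odd n" | (even) m where "n = m + m" "even m"
    | (half_odd) m where "n = (m + 2) + m" "even m"
  proof (cases "odd n")
    case True
    then show thesis using that(1) by (auto elim!: oddE simp: mult_2)
  next
    case False
    then obtain m where m: "n = m + m" by (auto elim!: evenE simp: mult_2)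
    show thesis
    proof (cases "even m")
      case True
      then show thesis using that(2) m by blast
    next
      case False
      have "n = (m - 1 + 2) + (m - 1)" using m n by simp
      moreover have "even (m - 1)" using False by simp
      ultimately show thesis using that(3) by blast
    qed
  qed
  then show ?thesis
  proof cases
    case odd
    then show ?thesis using P22_free_example_less[of m "m + 1"] n
      by (auto simp: power2_eq_square algebra_simps)
  next
    case even
    then show ?thesis using P22_free_example_even[of m]
      by (auto simp: power2_eq_square algebra_simps)
  next
    case half_odd
    then show ?thesis using P22_free_example_less[of m "m + 2"] n
      by (auto simp: power2_eq_square algebra_simps)
  qed
qed

theorem theorem2p1:
  fixes n :: nat
  assumes "n \<ge> 13"
  shows "4 * ex n = (if odd n then n\<^sup>2 + 4 * n - 1
                     else if even (n div 2) then n\<^sup>2 + 4 * n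
                     else n\<^sup>2 + 4 * n - 4)"
proof -
  let ?G = "{A :: (nat \<times> nat) set. strict_digraph {..<n} A \<and> P22_free A}"
  obtain A :: "(nat \<times> nat) set" where A: "A \<in> ?G"
    and card_A: "4 * card A = (if odd n then n\<^sup>2 + 4 * n - 1 else if even (n div 2) then n\<^sup>2 + 4 * n
      else n\<^sup>2 + 4 * n - 4)"
    using extremal_digraph[OF assms] by auto
  have "?G \<subseteq> Pow ({..<n} \<times> {..<n})" by (auto simp: strict_digraph_def)
  then have "finite ?G" by (rule finite_subset) simp
  moreover have "card A' \<le> card A" if "A' \<in> ?G" for A'
    using card_arcs_le[of "{..<n}" A' n] that assms unfolding card_A[symmetric] by simp
  ultimately have "Max (card ` ?G) = card A" using A by (intro Max_eqI) auto
  moreover have "ex n = Max (card ` ?G)" unfolding ex_def by (rule arg_cong[of _ _ Max]) blast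
  ultimately show ?thesis using card_A by simp
qed

end
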